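(* There is no stepsize schedule $\boldsymbol{\eta}=(\eta_k)_{k\in\mathbb{N}}\in(0,\infty)^{\mathbb{N}}$ such that $R_n(\boldsymbol{\eta})=o(n^{-4/3})$ as $n\to\infty$, i.e. such that $\lim_{n\to\infty} n^{4/3}R_n(\boldsymbol{\eta})=0$.
   Context: $\mathbb{N}=\{1,2,3,\ldots\}$, $\|\cdot\|$ is the $\ell_2$-norm. A differentiable function $f:\mathbb{R}^d\to\mathbb{R}$ is $1$-smooth if $\|\nabla f(x)-\nabla f(y)\|\le\|x-y\|$ for all $x,y\in\mathbb{R}^d$. Let $\mathscr{F}_1(\mathbb{R}^d)$ be the class of convex $1$-smooth functions $f:\mathbb{R}^d\to\mathbb{R}$ whose set of minimizers $X_f^\star=\arg\min_{x\in\mathbb{R}^d}f(x)$ is nonempty. Given a stepsize schedule $\boldsymbol{\eta}=(\eta_k)_{k\in\mathbb{N}}$ (a fixed sequence of positive numbers, not depending on $f$, the initial point or $n$), gradient descent (GD) on $f$ from $x_1\in\mathbb{R}^d$ generates $x_{k+1}=x_k-\eta_k\nabla f(x_k)$ for all $k\in\mathbb{N}$. The worst-case rate is $$R_n(\boldsymbol{\eta})=\sup_{d\in\mathbb{N}}\ \sup_{f\in\mathscr{F}_1(\mathbb{R}^d)}\ \sup_{x^\star\in X_f^\star}\ \sup_{x_1\in\mathbb{R}^d\setminus X_f^\star}\frac{f(x_{n+1})-f(x^\star)}{\frac12\|x_1-x^\star\|^2},$$ where $x_{n+1}$ is the GD iterate after $n$ steps on $f$ started at $x_1$. *)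

theory Defs
  imports "HOL-Analysis.Analysis"
begin

text \<open>
  The dimension \<open>d\<close> is quantified inside the worst-case rate, so it cannot be a type. All spaces
  \<open>\<real>\<^sup>d\<close> are therefore realised inside one real inner product space, the finitely supported real
  sequences with the \<open>\<ell>\<^sub>2\<close> inner product: \<open>\<real>\<^sup>d\<close> is the subspace of the sequences that vanish from
  index \<open>d\<close> on. (The library type of finitely supported functions carries the \<open>\<ell>\<^sub>1\<close> norm.)
\<close>

typedef rvec = "{x :: nat \<Rightarrow> real. finite {i. x i \<noteq> 0}}"
  morphisms coord Abs_rvec
  by (rule exI[of _ "\<lambda>_. 0"]) simp

setup_lifting type_definition_rvec

lemma rvec_eqI: "(\<And>i. coord x i = coord y i) \<Longrightarrow> x = y"
  by (simp add: coord_inject[symmetric] fun_eq_iff)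

lemma finite_coord: "finite {i. coord x i \<noteq> 0}"
  using coord[of x] by simp

instantiation rvec :: real_vector
begin

lift_definition zero_rvec :: rvec is "\<lambda>_. 0" by simp

lift_definition plus_rvec :: "rvec \<Rightarrow> rvec \<Rightarrow> rvec" is "\<lambda>x y i. x i + y i"
  subgoal for x y
    by (rule finite_subset[of _ "{i. x i \<noteq> 0} \<union> {i. y i \<noteq> 0}"]) auto
  done

lift_definition minus_rvec :: "rvec \<Rightarrow> rvec \<Rightarrow> rvec" is "\<lambda>x y i. x i - y i"
  subgoal for x y
    by (rule finite_subset[of _ "{i. x i \<noteq> 0} \<union> {i. y i \<noteq> 0}"]) auto
  done

lift_definition uminus_rvec :: "rvec \<Rightarrow> rvec" is "\<lambda>x i. - x i"
  by simp

lift_definition scaleR_rvec :: "real \<Rightarrow> rvec \<Rightarrow> rvec" is "\<lambda>r x i. r * x i"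
  by (erule finite_subset[rotated]) auto

instance
  by standard (transfer; simp add: fun_eq_iff algebra_simps)+

end

lemma coord_simps [simp]:
  "coord 0 i = 0"
  "coord (x + y) i = coord x i + coord y i"
  "coord (x - y) i = coord x i - coord y i"
  "coord (- x) i = - coord x i"
  "coord (r *\<^sub>R x) i = r * coord x i"
  by (transfer; simp)+

lemma coord_sum: "coord (sum f A) i = (\<Sum>a\<in>A. coord (f a) i)"
  by (induction A rule: infinite_finite_induct) auto

instantiation rvec :: real_inner
begin

definition inner_rvec :: "rvec \<Rightarrow> rvec \<Rightarrow> real"
  where "inner_rvec x y = (\<Sum>i | coord x i \<noteq> 0. coord x i * coord y i)"

definition norm_rvec :: "rvec \<Rightarrow> real"
  where "norm_rvec x = sqrt (inner x x)"

definition dist_rvec :: "rvec \<Rightarrow> rvec \<Rightarrow> real"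
  where "dist_rvec x y = norm (x - y)"

definition sgn_rvec :: "rvec \<Rightarrow> rvec"
  where "sgn_rvec x = x /\<^sub>R norm x"

definition uniformity_rvec :: "(rvec \<times> rvec) filter"
  where "uniformity_rvec = (INF e\<in>{0<..}. principal {(x, y). dist x y < e})"

definition open_rvec :: "rvec set \<Rightarrow> bool"
  where "open_rvec U \<longleftrightarrow> (\<forall>x\<in>U. \<forall>\<^sub>F (x', y) in uniformity. x' = x \<longrightarrow> y \<in> U)"

lemma inner_rvec_superset:
  assumes "finite A" "{i. coord x i \<noteq> 0} \<subseteq> A"
  shows "inner x y = (\<Sum>i\<in>A. coord x i * coord y i)"
  unfolding inner_rvec_def using assms by (intro sum.mono_neutral_left) auto

instance
proof
  fix x y z :: rvec and r :: real
  define A where "A = {i. coord x i \<noteq> 0} \<union> {i. coord y i \<noteq> 0}"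
  have A: "finite A" "{i. coord x i \<noteq> 0} \<subseteq> A" "{i. coord y i \<noteq> 0} \<subseteq> A"
      "{i. coord (x + y) i \<noteq> 0} \<subseteq> A" "{i. coord (r *\<^sub>R x) i \<noteq> 0} \<subseteq> A"
    unfolding A_def using finite_coord by auto
  show "inner x y = inner y x"
    using inner_rvec_superset[OF A(1,2)] inner_rvec_superset[OF A(1,3)]
    by (simp add: mult.commute)
  show "inner (x + y) z = inner x z + inner y z"
    using inner_rvec_superset[OF A(1,2)] inner_rvec_superset[OF A(1,3)]
      inner_rvec_superset[OF A(1,4)]
    by (simp add: algebra_simps sum.distrib)
  show "inner (r *\<^sub>R x) y = r * inner x y"
    using inner_rvec_superset[OF A(1,2)] inner_rvec_superset[OF A(1,5)]
    by (simp add: algebra_simps sum_distrib_left)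
  show "0 \<le> inner x x"
    by (simp add: inner_rvec_def sum_nonneg)
  show "inner x x = 0 \<longleftrightarrow> x = 0"
  proof
    assume "inner x x = 0"
    then have "\<forall>i\<in>{i. coord x i \<noteq> 0}. coord x i * coord x i = 0"
      unfolding inner_rvec_def by (subst (asm) sum_nonneg_eq_0_iff) (auto simp: finite_coord)
    then show "x = 0" by (intro rvec_eqI) auto
  qed (simp add: inner_rvec_def)
qed (simp_all add: norm_rvec_def dist_rvec_def sgn_rvec_def uniformity_rvec_def open_rvec_def)

end

definition Rd :: "nat \<Rightarrow> rvec set"
  where "Rd d = {x. \<forall>i\<ge>d. coord x i = 0}"

lemma inner_Rd: "x \<in> Rd d \<Longrightarrow> inner x y = (\<Sum>i<d. coord x i * coord y i)"
  by (rule inner_rvec_superset) (auto simp: Rd_def not_less[symmetric])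

lemma norm_Rd: "x \<in> Rd d \<Longrightarrow> norm x = L2_set (coord x) {..<d}"
  by (simp add: norm_eq_sqrt_inner inner_Rd L2_set_def power2_eq_square)

lemma coord_Rd_bij_betw: "bij_betw coord (Rd d) {x. \<forall>i\<ge>d. x i = 0}"
proof (intro bij_betwI[where g = Abs_rvec] Pi_I)
  fix x :: "nat \<Rightarrow> real" assume x: "x \<in> {x. \<forall>i\<ge>d. x i = 0}"
  have "{i. x i \<noteq> 0} \<subseteq> {..<d}" using x by (auto simp: not_less[symmetric])
  then have "finite {i. x i \<noteq> 0}" by (rule finite_subset) simp
  then show "coord (Abs_rvec x) = x" by (simp add: Abs_rvec_inverse)
  then show "Abs_rvec x \<in> Rd d" using x by (simp add: Rd_def)
qed (auto simp: Rd_def coord_inverse)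

lemma subspace_Rd: "subspace (Rd d)"
  by (auto simp: subspace_def Rd_def)

text \<open>
  Functions on \<open>\<real>\<^sup>d\<close> are total functions of which only the values on \<^term>\<open>Rd d\<close> matter;
  differentiability is relative to that subspace, and the gradient is an element of it.
\<close>

definition is_gradient :: "nat \<Rightarrow> (rvec \<Rightarrow> real) \<Rightarrow> rvec \<Rightarrow> rvec \<Rightarrow> bool"
  where "is_gradient d f x g \<longleftrightarrow>
    g \<in> Rd d \<and> (f has_derivative (\<lambda>h. inner g h)) (at x within Rd d)"

definition gradient :: "nat \<Rightarrow> (rvec \<Rightarrow> real) \<Rightarrow> rvec \<Rightarrow> rvec"
  where "gradient d f x = (THE g. is_gradient d f x g)"

definition one_smooth :: "nat \<Rightarrow> (rvec \<Rightarrow> real) \<Rightarrow> bool"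
  where "one_smooth d f \<longleftrightarrow> f differentiable_on Rd d \<and>
    (\<forall>x\<in>Rd d. \<forall>y\<in>Rd d. norm (gradient d f x - gradient d f y) \<le> norm (x - y))"

definition minimizers :: "nat \<Rightarrow> (rvec \<Rightarrow> real) \<Rightarrow> rvec set"
  where "minimizers d f = {x. is_arg_min f (\<lambda>y. y \<in> Rd d) x}"

definition F1 :: "nat \<Rightarrow> (rvec \<Rightarrow> real) set"
  where "F1 d = {f. convex_on (Rd d) f \<and> one_smooth d f \<and> minimizers d f \<noteq> {}}"

text \<open>
  Schedules are indexed from 1; the value \<open>\<eta> 0\<close> is never used. \<open>gd_iter d \<eta> f x\<^sub>1 n\<close> is the point
  reached after \<open>n\<close> steps, that is \<open>x\<^bsub>n+1\<^esub>\<close>.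
\<close>

primrec gd_iter :: "nat \<Rightarrow> (nat \<Rightarrow> real) \<Rightarrow> (rvec \<Rightarrow> real) \<Rightarrow> rvec \<Rightarrow> nat \<Rightarrow> rvec"
  where
    "gd_iter d \<eta> f x1 0 = x1"
  | "gd_iter d \<eta> f x1 (Suc n) =
       gd_iter d \<eta> f x1 n - \<eta> (Suc n) *\<^sub>R gradient d f (gd_iter d \<eta> f x1 n)"

text \<open>
  The supremum is taken in \<^typ>\<open>ereal\<close>, so that no boundedness is presupposed. For a constant \<open>f\<close>
  the innermost supremum is over the empty set, hence \<open>-\<infinity>\<close>, and does not contribute.
\<close>

definition worst_case_rate :: "(nat \<Rightarrow> real) \<Rightarrow> nat \<Rightarrow> ereal"
  where "worst_case_rate \<eta> n =
    (SUP d\<in>{1..}. SUP f\<in>F1 d. SUP xs\<in>minimizers d f. SUP x1\<in>Rd d - minimizers d f.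
       ereal ((f (gd_iter d \<eta> f x1 n) - f xs) / ((1/2) * (norm (x1 - xs))\<^sup>2)))"

text \<open>The gradient exists, and is unique, at every point of differentiability.\<close>

lemma is_gradient_unique:
  assumes x: "x \<in> Rd d" and g: "is_gradient d f x g" "is_gradient d f x g'"
  shows "g = g'"
proof -
  define h where "h = g - g'"
  have h: "h \<in> Rd d" using g unfolding h_def is_gradient_def
    by (simp add: subspace_diff subspace_Rd)
  have line: "((\<lambda>t::real. x + t *\<^sub>R h) has_derivative (\<lambda>t. t *\<^sub>R h)) (at 0)"
    by (auto intro!: derivative_eq_intros)
  have img: "range (\<lambda>t::real. x + t *\<^sub>R h) \<subseteq> Rd d"
    using x h by (auto intro!: subspace_add subspace_scale subspace_Rd)
  have "((\<lambda>t. f (x + t *\<^sub>R h)) has_derivative (\<lambda>t. inner u (t *\<^sub>R h))) (at 0)"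
    if "is_gradient d f x u" for u
  proof -
    have "(f has_derivative (\<lambda>h. inner u h)) (at (x + 0 *\<^sub>R h) within range (\<lambda>t::real. x + t *\<^sub>R h))"
      using that img by (auto simp: is_gradient_def intro: has_derivative_subset)
    from has_derivative_in_compose[OF line this] show ?thesis by simp
  qed
  from this[OF g(1)] this[OF g(2)]
  have "(\<lambda>t::real. inner g (t *\<^sub>R h)) = (\<lambda>t. inner g' (t *\<^sub>R h))"
    by (rule has_derivative_unique)
  from fun_cong[OF this, of 1] have "inner h h = 0"
    by (simp add: h_def inner_diff_left)
  then show ?thesis by (simp add: h_def)
qed

lemma is_gradient_gradient:
  assumes f: "f differentiable (at x within Rd d)" and x: "x \<in> Rd d"
  shows "is_gradient d f x (gradient d f x)"
proof -
  obtain D where D: "(f has_derivative D) (at x within Rd d)"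
    using f by (auto simp: differentiable_def)
  interpret D: bounded_linear D using D by (rule has_derivative_bounded_linear)
  define e where "e i = Abs_rvec (\<lambda>j. if j = i then 1 else 0)" for i
  have e: "coord (e i) j = (if j = i then 1 else 0)" for i j
    by (simp add: e_def Abs_rvec_inverse)
  define g where "g = (\<Sum>i<d. D (e i) *\<^sub>R e i)"
  have cg: "coord g j = (if j < d then D (e j) else 0)" for j
    by (simp add: g_def coord_sum e if_distrib cong: if_cong)
  have g: "g \<in> Rd d" by (simp add: Rd_def cg)
  have Dg: "D h = inner g h" if h: "h \<in> Rd d" for h
  proof -
    have "h = (\<Sum>i<d. coord h i *\<^sub>R e i)"
      using h by (intro rvec_eqI) (auto simp: coord_sum e Rd_def if_distrib cong: if_cong)
    then have "D h = D (\<Sum>i<d. coord h i *\<^sub>R e i)" by simp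
    also have "\<dots> = (\<Sum>i<d. coord h i * D (e i))"
      by (simp add: D.sum D.scaleR)
    finally show ?thesis by (simp add: inner_Rd[OF g] cg mult.commute)
  qed
  have "(f has_derivative (\<lambda>h. inner g h)) (at x within Rd d)"
  proof (rule has_derivativeI_sandwich[where e = 1 and H = "\<lambda>y. norm ((f y - f x - D (y - x)) /\<^sub>R norm (y - x))"])
    show "bounded_linear (inner g)" by (rule bounded_linear_inner_right)
    show "((\<lambda>y. norm ((f y - f x - D (y - x)) /\<^sub>R norm (y - x))) \<longlongrightarrow> 0) (at x within Rd d)"
      using D unfolding has_derivative_at_within by (intro tendsto_norm_zero) (simp add: diff_diff_eq)
  next
    fix y assume "y \<in> Rd d"
    then have "D (y - x) = inner g (y - x)"
      using x by (intro Dg) (simp add: subspace_diff subspace_Rd)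
    then show "norm (f y - f x - inner g (y - x)) / norm (y - x)
        \<le> norm ((f y - f x - D (y - x)) /\<^sub>R norm (y - x))"
      by (simp add: abs_mult divide_inverse mult.commute)
  qed simp
  with g have ex: "is_gradient d f x g" by (simp add: is_gradient_def)
  show ?thesis unfolding gradient_def
    using ex is_gradient_unique[OF x _ ex] by (rule theI)
qed

end

theory Submission
  imports Defs "HOL-Complex_Analysis.Conformal_Mappings" "HOL-Real_Asymp.Real_Asymp"
begin

text \<open>
  Write \<open>S\<^sub>n = \<eta>\<^sub>1 + \<dots> + \<eta>\<^sub>n\<close>, and suppose that the rate is at most \<open>\<epsilon> n\<^bsup>-4/3\<^esup>\<close> from some \<open>n\<close> on.
  One-dimensional examples give three constraints. A Huber function on which all gradients seen are
  equal gives \<open>S\<^sub>n \<ge> c n\<^bsup>4/3\<^esup>\<close> with \<open>c\<close> of order \<open>1/\<epsilon>\<close>. A Huber function whose kink is reached just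
  before a step gives \<open>\<eta>\<^sub>n \<le> 1 + \<surd>\<epsilon> n\<^bsup>-2/3\<^esup> (1 + S\<^sub>n)\<close>; in particular \<open>ln S\<^sub>n = O(n\<^bsup>1/3\<^esup>)\<close>. The quadratics
  \<open>l x\<^sup>2 / 2\<close> bound the polynomial \<open>P(l) = (1 - l \<eta>\<^sub>1) \<dots> (1 - l \<eta>\<^sub>n)\<close> by \<open>l P(l)\<^sup>2 \<le> 1\<close> on \<open>(0, 1]\<close>.

  Every step \<open>\<ge> T\<close> contributes a factor of modulus \<open>\<ge> 3\<close> to \<open>P\<close> on \<open>[4/T, 1]\<close>, while by Chebyshev's
  extremal property the other factors shrink the maximum over this interval by no more than
  \<open>exp (- 8 n / \<surd>T)\<close>. So there are \<open>O(n / \<surd>T + ln T)\<close> such steps, and if all steps are \<open>\<le> H\<close>,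
  summing over \<open>T = 4\<^sup>i \<le> H\<close> gives \<open>S\<^sub>n = O(n \<surd>H + H ln H)\<close>. At a record \<open>n\<close> of \<open>n\<^bsup>-2/3\<^esup> S\<^sub>n\<close> one can
  take \<open>H\<close> of order \<open>\<surd>\<epsilon> n\<^bsup>-2/3\<^esup> S\<^sub>n\<close>. This forces \<open>S\<^sub>n = O(\<surd>\<epsilon> n\<^bsup>4/3\<^esup>)\<close>, contradicting the first
  constraint for small \<open>\<epsilon>\<close>.
\<close>

section \<open>Functions of one variable\<close>

definition e0 :: rvec
  where "e0 = Abs_rvec (\<lambda>j. if j = 0 then 1 else 0)"

lemma coord_e0: "coord e0 j = (if j = 0 then 1 else 0)"
  by (simp add: e0_def Abs_rvec_inverse)

lemma e0_Rd: "t *\<^sub>R e0 \<in> Rd 1"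
  by (simp add: Rd_def coord_e0)

lemma inner_e0: "inner e0 x = coord x 0"
  using inner_Rd[of e0 1 x] e0_Rd[of 1] by (simp add: coord_e0)

lemma norm_e0: "norm e0 = 1"
  by (simp add: norm_eq_sqrt_inner inner_e0 coord_e0)

lemma bounded_linear_coord: "bounded_linear (\<lambda>x. coord x 0)"
  using bounded_linear_inner_right[of e0] by (simp add: inner_e0)

text \<open>One-dimensional test functions suffice for lower bounds, since the rate is a supremum
  over all \<open>d\<close>. The minimizer is normalised to 0 and the start will be
  \<open>e0\<close>, at distance 1 from it.\<close>

locale smooth_convex_real =
  fixes F G :: "real \<Rightarrow> real"
  assumes deriv: "\<And>t. (F has_real_derivative G t) (at t)"
    and mono: "mono G"
    and Lipschitz: "\<And>s t. \<bar>G s - G t\<bar> \<le> \<bar>s - t\<bar>"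
    and min_0: "\<And>t. F 0 \<le> F t"
begin

definition "lift x = F (coord x 0)"

lemma has_derivative_lift:
  "(lift has_derivative (\<lambda>h. inner (G (coord x 0) *\<^sub>R e0) h)) (at x within S)"
proof -
  have "((\<lambda>x. coord x 0) has_derivative (\<lambda>x. coord x 0)) (at x within S)"
    by (rule bounded_linear.has_derivative[OF bounded_linear_coord has_derivative_ident])
  moreover have "(F has_derivative (*) (G (coord x 0))) (at (coord x 0))"
    using deriv by (simp add: has_field_derivative_def)
  ultimately have "((\<lambda>x. F (coord x 0)) has_derivative (\<lambda>h. G (coord x 0) * coord h 0)) (at x within S)"
    by (rule has_derivative_compose)
  then show ?thesis by (simp add: lift_def[abs_def] inner_e0)
qed

lemma gradient_lift: "x \<in> Rd 1 \<Longrightarrow> gradient 1 lift x = G (coord x 0) *\<^sub>R e0"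
proof -
  assume x: "x \<in> Rd 1"
  have g: "is_gradient 1 lift x (G (coord x 0) *\<^sub>R e0)"
    unfolding is_gradient_def using e0_Rd has_derivative_lift by blast
  show ?thesis
    unfolding gradient_def using g is_gradient_unique[OF x _ g] by (rule the_equality)
qed

lemma zero_minimizer: "0 \<in> minimizers 1 lift"
  using min_0 by (auto simp: minimizers_def is_arg_min_def lift_def Rd_def not_less)

lemma lift_F1: "lift \<in> F1 1"
proof -
  have F: "convex_on UNIV F"
    by (rule convex_on_realI[where f' = G]) (use deriv mono in \<open>auto simp: mono_def\<close>)
  have "convex (Rd 1)" by (simp add: subspace_Rd subspace_imp_convex)
  then have "convex_on (Rd 1) lift"
    using F by (auto simp: convex_on_def lift_def)
  moreover have "lift differentiable_on Rd 1"
    using has_derivative_lift by (auto simp: differentiable_on_def differentiable_def)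
  moreover have "norm (gradient 1 lift x - gradient 1 lift y) \<le> norm (x - y)"
    if "x \<in> Rd 1" "y \<in> Rd 1" for x y
  proof -
    have "norm (gradient 1 lift x - gradient 1 lift y) = \<bar>G (coord x 0) - G (coord y 0)\<bar>"
      using that by (simp only: gradient_lift scaleR_diff_left[symmetric] norm_scaleR norm_e0) simp
    also have "\<dots> \<le> \<bar>inner e0 (x - y)\<bar>"
      using Lipschitz by (simp add: inner_e0)
    also have "\<dots> \<le> norm (x - y)"
      using Cauchy_Schwarz_ineq2[of e0 "x - y"] by (simp add: norm_e0)
    finally show ?thesis .
  qed
  ultimately show ?thesis
    using zero_minimizer by (auto simp: F1_def one_smooth_def)
qed

lemma gd_iter_lift:
  assumes "y 0 = 1" "\<And>k. y (Suc k) = y k - \<eta> (Suc k) * G (y k)"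
  shows "gd_iter 1 \<eta> lift e0 n = y n *\<^sub>R e0"
proof (induction n)
  case (Suc n)
  moreover have "gradient 1 lift (y n *\<^sub>R e0) = G (y n) *\<^sub>R e0"
    using gradient_lift[OF e0_Rd, of "y n"] by (simp add: coord_e0)
  ultimately show ?case
    by (simp only: gd_iter.simps assms(2) scaleR_diff_left scaleR_scaleR)
qed (use assms in simp)

text \<open>Since \<open>e0\<close> has distance 1 from the minimizer 0, the denominator of the rate
  is 1/2, whence the factor 2. The hypothesis \<open>F 0 < F 1\<close> makes \<open>e0\<close>
  admissible, that is, not a minimizer. The sequence \<open>y\<close> is gradient descent in the
  single coordinate.\<close>

lemma worst_case_rate_ge:
  assumes "F 0 < F 1"
    and "y 0 = 1" "\<And>k. y (Suc k) = y k - \<eta> (Suc k) * G (y k)"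
  shows "ereal (2 * (F (y n) - F 0)) \<le> worst_case_rate \<eta> n"
proof -
  have e0: "e0 \<in> Rd 1 - minimizers 1 lift"
    using e0_Rd[of 1] \<open>F 0 < F 1\<close> zero_minimizer
    by (auto simp: minimizers_def is_arg_min_def lift_def coord_e0 intro!: exI[of _ 0])
  have "ereal (2 * (F (y n) - F 0)) =
      ereal ((lift (gd_iter 1 \<eta> lift e0 n) - lift 0) / ((1/2) * (norm (e0 - 0))\<^sup>2))"
    by (simp only: gd_iter_lift[OF assms(2,3)] lift_def) (simp add: norm_e0 coord_e0)
  also have "\<dots> \<le> worst_case_rate \<eta> n"
    unfolding worst_case_rate_def
    by (rule SUP_upper2[of 1], simp, rule SUP_upper2[OF lift_F1], rule SUP_upper2[OF zero_minimizer],
        rule SUP_upper2[OF e0], simp)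
  finally show ?thesis .
qed

end

section \<open>Lower bounds for the rate\<close>

definition step_sum :: "(nat \<Rightarrow> real) \<Rightarrow> nat \<Rightarrow> real"
  where "step_sum \<eta> n = (\<Sum>k=1..n. \<eta> k)"

lemma step_sum_Suc [simp]: "step_sum \<eta> (Suc n) = step_sum \<eta> n + \<eta> (Suc n)"
  by (simp add: step_sum_def)

lemma step_sum_0 [simp]: "step_sum \<eta> 0 = 0"
  by (simp add: step_sum_def)

lemma step_sum_mono:
  assumes "\<forall>k\<ge>1. 0 < \<eta> k" "m \<le> n"
  shows "step_sum \<eta> m \<le> step_sum \<eta> n"
  unfolding step_sum_def using assms by (intro sum_mono2) (auto intro: less_imp_le)

lemma step_sum_nonneg: "\<forall>k\<ge>1. 0 < \<eta> k \<Longrightarrow> 0 \<le> step_sum \<eta> n"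
  using step_sum_mono[of \<eta> 0 n] by simp

text \<open>On \<open>l * t\<^sup>2 / 2\<close> the k-th step multiplies the iterate by
  \<open>1 - l * \<eta> k\<close>.\<close>

lemma rate_ge_quadratic:
  assumes "0 < l" "l \<le> 1"
  shows "ereal (l * (\<Prod>k=1..n. 1 - l * \<eta> k)\<^sup>2) \<le> worst_case_rate \<eta> n"
proof -
  interpret smooth_convex_real "\<lambda>t. l * t\<^sup>2 / 2" "\<lambda>t. l * t"
  proof
    fix s t :: real
    show "((\<lambda>t. l * t\<^sup>2 / 2) has_real_derivative l * t) (at t)"
      by (auto intro!: derivative_eq_intros)
    have "\<bar>l * s - l * t\<bar> = l * \<bar>s - t\<bar>"
      using assms by (simp add: right_diff_distrib[symmetric] abs_mult)
    then show "\<bar>l * s - l * t\<bar> \<le> \<bar>s - t\<bar>"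
      using assms mult_right_mono[of l 1 "\<bar>s - t\<bar>"] by simp
  qed (use assms in \<open>auto simp: mono_def\<close>)
  have "ereal (2 * (l * (\<Prod>k=1..n. 1 - l * \<eta> k)\<^sup>2 / 2 - l * 0\<^sup>2 / 2)) \<le> worst_case_rate \<eta> n"
    by (rule worst_case_rate_ge) (use assms in \<open>auto simp: algebra_simps\<close>)
  then show ?thesis by simp
qed

text \<open>A one-sided Huber function: only the branch to the right of \<open>d\<close> is linear,
  so an iterate that overshoots to the left, even far beyond 0, still has its full quadratic
  value.\<close>

definition huber :: "real \<Rightarrow> real \<Rightarrow> real"
  where "huber d t = (if t \<le> d then t\<^sup>2 / 2 else d * t - d\<^sup>2 / 2)"

text \<open>A quadratic bound on the Taylor remainder that also holds across the kink yields the
  derivative at every point at once. If \<open>s\<close> and \<open>t\<close> lie on different sides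
  of \<open>d\<close>, then \<open>s\<close> is at least as close to \<open>d\<close> as to
  \<open>t\<close>.\<close>

lemma huber_quadratic_remainder:
  "\<bar>huber d s - huber d t - min t d * (s - t)\<bar> \<le> (s - t)\<^sup>2"
proof -
  have mono: "(s - d)\<^sup>2 \<le> (s - t)\<^sup>2" if "s \<le> d \<and> d < t \<or> d < s \<and> t \<le> d"
    using that by (auto simp: abs_le_square_iff[symmetric])
  consider "s \<le> d" "t \<le> d" | "s \<le> d" "d < t" | "d < s" "t \<le> d" | "d < s" "d < t" by linarith
  then show ?thesis
  proof cases
    case 1
    then have eq: "huber d s - huber d t - min t d * (s - t) = (s - t)\<^sup>2 / 2"
      by (simp add: huber_def power2_eq_square field_simps)
    show ?thesis unfolding eq by simp
  next
    case 2
    then have eq: "huber d s - huber d t - min t d * (s - t) = (s - d)\<^sup>2 / 2"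
      by (simp add: huber_def power2_eq_square field_simps)
    have "0 \<le> (s - d)\<^sup>2" by simp
    then show ?thesis unfolding eq using mono 2 by linarith
  next
    case 3
    then have eq: "huber d s - huber d t - min t d * (s - t) = ((s - t)\<^sup>2 - (s - d)\<^sup>2) / 2"
      by (simp add: huber_def power2_eq_square field_simps)
    show ?thesis unfolding eq using mono 3 by simp
  next
    case 4
    then have eq: "huber d s - huber d t - min t d * (s - t) = 0"
      by (simp add: huber_def algebra_simps)
    show ?thesis unfolding eq by simp
  qed
qed

lemma has_derivative_huber: "(huber d has_real_derivative min t d) (at t)"
  unfolding DERIV_def
proof (rule LIM_I)
  fix r :: real assume "0 < r"
  moreover have "\<bar>(huber d (t + h) - huber d t) / h - min t d\<bar> \<le> \<bar>h\<bar>" if "h \<noteq> 0" for h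
  proof -
    have "\<bar>(huber d (t + h) - huber d t) / h - min t d\<bar> * \<bar>h\<bar>
        = \<bar>huber d (t + h) - huber d t - min t d * h\<bar>"
      using that by (simp only: abs_mult[symmetric] left_diff_distrib[of "_ / h"]) simp
    also have "\<dots> \<le> \<bar>h\<bar> * \<bar>h\<bar>"
      using huber_quadratic_remainder[of d "t + h" t] by (simp add: power2_eq_square)
    finally show ?thesis by (rule mult_right_le_imp_le) (use that in simp)
  qed
  ultimately show "\<exists>s>0. \<forall>h. h \<noteq> 0 \<and> norm (h - 0) < s \<longrightarrow>
      norm ((huber d (t + h) - huber d t) / h - min t d) < r"
    by (intro exI[of _ r]) (force intro: le_less_trans)
qed

lemma smooth_convex_huber: "0 < d \<Longrightarrow> smooth_convex_real (huber d) (\<lambda>t. min t d)"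
proof
  fix t assume "0 < d"
  then show "huber d 0 \<le> huber d t"
    using mult_left_mono[of d t d] mult_nonneg_nonneg[of d t]
    by (auto simp: huber_def power2_eq_square)
next
  fix s t show "\<bar>min s d - min t d\<bar> \<le> \<bar>s - t\<bar>" by linarith
qed (auto simp: has_derivative_huber mono_def)

text \<open>The hypothesis on \<open>d\<close> says
  \<open>d \<le> 1 - d * step_sum \<eta> n\<close>: none of the iterates up to index
  \<open>n\<close> lies below the kink, so every gradient seen equals \<open>d\<close>.\<close>

lemma huber_trajectory:
  assumes "\<forall>k\<ge>1. 0 < \<eta> k" "0 < d" "d * (1 + step_sum \<eta> n) \<le> 1"
    and "y 0 = 1" "\<And>k. y (Suc k) = y k - \<eta> (Suc k) * min (y k) d"
  shows "k \<le> n \<Longrightarrow> y k = 1 - d * step_sum \<eta> k"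
proof (induction k)
  case (Suc k)
  have "d * step_sum \<eta> k \<le> d * step_sum \<eta> n"
    using assms(1,2) Suc.prems by (intro mult_left_mono step_sum_mono) auto
  then have "d \<le> 1 - d * step_sum \<eta> k" using assms(3) by (simp add: algebra_simps)
  then have "min (y k) d = d" using Suc by simp
  then show ?case using Suc assms(5)[of k] by (simp add: algebra_simps)
qed (use assms in simp)

lemma rate_ge_step_sum:
  assumes "\<forall>k\<ge>1. 0 < \<eta> k"
  shows "ereal (1 / (2 * step_sum \<eta> n + 1)) \<le> worst_case_rate \<eta> n"
proof -
  \<comment> \<open>On the linear branch, twice the final gap is
    \<open>2 * d * (1 - d * S - d / 2)\<close> with \<open>S = step_sum \<eta> n\<close>. This
    \<open>d\<close> maximises it, and the maximum is \<open>d\<close> itself.\<close>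
  define d where "d = 1 / (2 * step_sum \<eta> n + 1)"
  note S = step_sum_nonneg[OF assms, of n]
  have d: "0 < d" "d \<le> 1" "d * (2 * step_sum \<eta> n + 1) = 1" using S by (auto simp: d_def)
  have d': "d * (1 + step_sum \<eta> n) \<le> 1" using S mult_nonneg_nonneg[of d "step_sum \<eta> n"] d
    by (simp add: algebra_simps)
  interpret smooth_convex_real "huber d" "\<lambda>t. min t d" by (rule smooth_convex_huber) fact
  define y where "y = rec_nat 1 (\<lambda>k t. t - \<eta> (Suc k) * min t d)"
  have y: "y 0 = 1" "y (Suc k) = y k - \<eta> (Suc k) * min (y k) d" for k by (simp_all add: y_def)
  have yn: "y n = 1 - d * step_sum \<eta> n"
    by (rule huber_trajectory[where y = y, OF assms d(1) d' y]) simp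
  have "d \<le> y n" using yn d' by (simp add: algebra_simps)
  then have "huber d (y n) = d * (y n - d / 2)"
    by (auto simp: huber_def power2_eq_square algebra_simps)
  also have "y n - d / 2 = 1 / 2" using d yn by (simp add: algebra_simps)
  finally have "2 * (huber d (y n) - huber d 0) = d" using d by (simp add: huber_def)
  moreover have "huber d 0 < huber d 1"
    using d mult_strict_mono'[of d 2 d 1] by (auto simp: huber_def power2_eq_square)
  ultimately show ?thesis using worst_case_rate_ge[where y = y and n = n, OF _ y] by (simp add: d_def)
qed

lemma rate_ge_step:
  assumes "\<forall>k\<ge>1. 0 < \<eta> k"
  shows "ereal (((\<eta> (Suc n) - 1) / (1 + step_sum \<eta> n))\<^sup>2) \<le> worst_case_rate \<eta> (Suc n)"
proof -
  \<comment> \<open>This \<open>d\<close> puts the iterate after \<open>n\<close> steps exactly at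
    the kink. The next gradient is still \<open>d\<close>, and the step leads to
    \<open>d * (1 - \<eta> (Suc n))\<close> on the quadratic branch.\<close>
  define d where "d = 1 / (1 + step_sum \<eta> n)"
  note S = step_sum_nonneg[OF assms, of n]
  have d: "0 < d" "d \<le> 1" "d * (1 + step_sum \<eta> n) = 1" using S by (auto simp: d_def)
  interpret smooth_convex_real "huber d" "\<lambda>t. min t d" by (rule smooth_convex_huber) fact
  define y where "y = rec_nat 1 (\<lambda>k t. t - \<eta> (Suc k) * min t d)"
  have y: "y 0 = 1" "y (Suc k) = y k - \<eta> (Suc k) * min (y k) d" for k by (simp_all add: y_def)
  have "y n = 1 - d * step_sum \<eta> n"
    by (rule huber_trajectory[where y = y, OF assms d(1) _ y]) (use d in auto)
  then have yn: "y n = d" using d by (simp add: algebra_simps)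
  have "0 \<le> \<eta> (Suc n) * d" using assms d by (auto intro: less_imp_le)
  then have "y (Suc n) \<le> d" using y(2)[of n] yn by simp
  then have "huber d (y (Suc n)) = (d - \<eta> (Suc n) * d)\<^sup>2 / 2"
    using y(2)[of n] yn by (simp add: huber_def)
  also have "d - \<eta> (Suc n) * d = - ((\<eta> (Suc n) - 1) / (1 + step_sum \<eta> n))"
    using S by (simp add: d_def field_simps)
  finally have "2 * (huber d (y (Suc n)) - huber d 0) = ((\<eta> (Suc n) - 1) / (1 + step_sum \<eta> n))\<^sup>2"
    using d by (simp add: huber_def)
  moreover have "huber d 0 < huber d 1"
    using d mult_strict_mono'[of d 2 d 1] by (auto simp: huber_def power2_eq_square)
  ultimately show ?thesis using worst_case_rate_ge[where y = y and n = "Suc n", OF _ y] by simp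
qed

section \<open>Long steps are rare\<close>

text \<open>
  The Joukowski map \<open>z \<mapsto> (1 + a)/2 + (1 - a)/4 \<cdot> (z + 1/z)\<close> sends the unit circle to \<open>[a, 1]\<close> and
  \<open>-(1 - \<surd>a)/(1 + \<surd>a)\<close> to \<open>0\<close>; the claim is the maximum principle for \<open>z ^ card A\<close> times
  the product.
\<close>

lemma Chebyshev_lower_bound:
  fixes \<eta> :: "'k \<Rightarrow> real"
  assumes "finite A" "0 < a" "a < 1"
  shows "\<exists>l\<in>{a..1}. ((1 - sqrt a) / (1 + sqrt a)) ^ card A \<le> \<bar>\<Prod>k\<in>A. 1 - l * \<eta> k\<bar>"
proof (rule ccontr)
  assume "\<not> ?thesis"
  then have small: "\<bar>\<Prod>k\<in>A. 1 - l * \<eta> k\<bar> < ((1 - sqrt a) / (1 + sqrt a)) ^ card A"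
    if "l \<in> {a..1}" for l using that by (auto simp: not_le)
  define s where "s = sqrt a"
  have s: "0 < s" "s < 1" "a = s\<^sup>2" using assms by (auto simp: s_def)
  \<comment> \<open>Each factor is \<open>z\<close> times 1 minus \<open>\<eta> k\<close> times the
    Joukowski image of \<open>z\<close>. The extra \<open>z\<close> removes the pole at 0 and does
    not change the modulus on the circle.\<close>
  define h :: "complex \<Rightarrow> complex" where
    "h z = (\<Prod>k\<in>A. z - of_real (\<eta> k) * (of_real ((1 + a) / 2) * z + of_real ((1 - a) / 4) * (z\<^sup>2 + 1)))" for z
  define l where "l z = (1 + a) / 2 + (1 - a) / 2 * Re z" for z
  have on_circle: "norm (h z) = \<bar>\<Prod>k\<in>A. 1 - l z * \<eta> k\<bar>" if "norm z = 1" for z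
  proof -
    \<comment> \<open>On the circle 1/z is the conjugate of \<open>z\<close>, so the Joukowski image
      is the real number \<open>l z\<close>.\<close>
    have "z * cnj z = 1" using that complex_norm_square[of z] by simp
    then have z2: "z\<^sup>2 + 1 = z * of_real (2 * Re z)"
      by (simp only: complex_add_cnj[symmetric] power2_eq_square distrib_left)
    have fac: "z - of_real (\<eta> k) * (of_real ((1 + a) / 2) * z + of_real ((1 - a) / 4) * (z\<^sup>2 + 1))
        = z * of_real (1 - l z * \<eta> k)" for k
      unfolding z2 by (simp add: l_def field_simps)
    have "h z = z ^ card A * of_real (\<Prod>k\<in>A. 1 - l z * \<eta> k)"
      unfolding h_def fac by (simp add: prod.distrib)
    then show ?thesis using that by (simp add: norm_mult norm_power del: of_real_prod)
  qed
  have l_range: "l z \<in> {a..1}" if "norm z = 1" for z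
  proof -
    have "-1 \<le> Re z" "Re z \<le> 1" using abs_Re_le_cmod[of z] that by auto
    then have "(1 - a) / 2 * (-1) \<le> (1 - a) / 2 * Re z" "(1 - a) / 2 * Re z \<le> (1 - a) / 2 * 1"
      using assms by (intro mult_left_mono; simp)+
    then show ?thesis by (simp add: l_def field_simps)
  qed
  \<comment> \<open>The Joukowski image of \<open>z0\<close> is 0, where every factor of the
    original product is 1; hence \<open>h\<close> takes the value \<open>z0 ^ card A\<close>
    there.\<close>
  define z0 where "z0 = - ((1 - s) / (1 + s))"
  have z0: "(1 + a) / 2 * z0 + (1 - a) / 4 * (z0\<^sup>2 + 1) = 0"
  proof -
    have "1 + s \<noteq> 0" using s by simp
    then show ?thesis unfolding z0_def s(3)
      by (simp add: divide_simps) (simp add: power2_eq_square algebra_simps)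
  qed
  have "h (of_real z0) = (\<Prod>k\<in>A. of_real (z0 - \<eta> k * ((1 + a) / 2 * z0 + (1 - a) / 4 * (z0\<^sup>2 + 1))))"
    unfolding h_def by (intro prod.cong) auto
  then have "h (of_real z0) = of_real (z0 ^ card A)" by (simp only: z0) simp
  then have hz0: "norm (h (of_real z0)) = ((1 - s) / (1 + s)) ^ card A"
    using s by (simp add: norm_power z0_def del: of_real_power)
  have holo: "h holomorphic_on UNIV"
    unfolding h_def[abs_def] by (intro holomorphic_intros)
  have cont: "continuous_on UNIV h" using holo by (rule holomorphic_on_imp_continuous_on)
  obtain w where w: "norm w = 1" "\<And>z. norm z = 1 \<Longrightarrow> norm (h z) \<le> norm (h w)"
  proof -
    have "compact (sphere (0::complex) 1)" by simp
    moreover have "sphere (0::complex) 1 \<noteq> {}" by (auto intro: exI[of _ 1])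
    moreover have "continuous_on (sphere 0 1) (\<lambda>z. norm (h z))"
      using cont by (intro continuous_on_norm) (auto intro: continuous_on_subset)
    ultimately obtain w where "w \<in> sphere 0 1" "\<forall>z\<in>sphere 0 1. norm (h z) \<le> norm (h w)"
      using continuous_attains_sup by blast
    then show ?thesis using that by (simp add: dist_norm)
  qed
  have "norm (h (of_real z0)) \<le> norm (h w)"
  proof (rule maximum_modulus_frontier[of h "ball 0 1"])
    show "h holomorphic_on interior (ball 0 1)" using holo by (rule holomorphic_on_subset) simp
    show "continuous_on (closure (ball 0 1)) h" using cont by (rule continuous_on_subset) simp
    have "\<bar>z0\<bar> < 1" using s by (simp add: z0_def field_simps)
    then show "of_real z0 \<in> ball (0::complex) 1" by simp
  qed (use w in \<open>auto simp: dist_norm\<close>)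
  then show False
    using small[OF l_range[OF w(1)]] on_circle[OF w(1)] hz0 by (simp add: s_def)
qed


text \<open>The point \<open>l\<close> in \<open>{4 / T..1}\<close> is the one that
  \<open>Chebyshev_lower_bound\<close> supplies for the short steps. There a long step satisfies
  \<open>4 \<le> l * \<eta> k\<close>, and the claim is the logarithm of \<open>bound\<close> at
  \<open>l\<close>, with \<open>l\<close> estimated from below by \<open>4 / T\<close>.\<close>

lemma card_long_steps:
  fixes \<eta> :: "'k \<Rightarrow> real"
  assumes "finite A" "16 \<le> T"
    and bound: "\<And>l. 0 < l \<Longrightarrow> l \<le> 1 \<Longrightarrow> l * (\<Prod>k\<in>A. 1 - l * \<eta> k)\<^sup>2 \<le> 1"
  shows "real (card {k\<in>A. T \<le> \<eta> k}) \<le> 8 * real (card A) / sqrt T + ln T / 2"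
proof -
  define B where "B = {k\<in>A. T \<le> \<eta> k}"
  define N where "N = real (card B)"
  define a where "a = 4 / T"
  define s where "s = sqrt a"
  have a: "0 < a" "a \<le> 1 / 4" "a < 1" using assms by (auto simp: a_def field_simps)
  have "s \<le> sqrt ((1 / 2)\<^sup>2)"
    unfolding s_def using a by (intro real_sqrt_le_mono) (simp add: power2_eq_square)
  then have s: "0 < s" "s \<le> 1 / 2" "s = 2 / sqrt T" using a
    by (auto simp: s_def a_def real_sqrt_divide)
  obtain l where l: "a \<le> l" "l \<le> 1"
      "((1 - s) / (1 + s)) ^ card (A - B) \<le> \<bar>\<Prod>k\<in>A - B. 1 - l * \<eta> k\<bar>"
    using Chebyshev_lower_bound[of "A - B" a \<eta>] assms(1) a by (auto simp: s_def)
  \<comment> \<open>This uses \<open>s \<le> 1 / 2\<close>, which is what \<open>16 \<le> T\<close>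
    provides.\<close>
  have "exp (- 4 * s) \<le> (1 - s) / (1 + s)"
  proof -
    have "1 + s \<le> (1 - s) * (1 + 4 * s)"
      using mult_left_mono[of s "1/2" s] s(1,2) by (simp add: algebra_simps)
    also have "\<dots> \<le> (1 - s) * exp (4 * s)" using s by (intro mult_left_mono exp_ge_add_one_self) auto
    finally show ?thesis using s(1,2) by (simp add: exp_minus field_simps)
  qed
  then have "exp (- 4 * s) ^ card (A - B) \<le> ((1 - s) / (1 + s)) ^ card (A - B)"
    by (intro power_mono) auto
  moreover have "exp (- 4 * s * real (card A)) \<le> exp (- 4 * s) ^ card (A - B)"
    using s(1) card_mono[of A "A - B"] assms(1) by (simp add: exp_of_nat_mult[symmetric] mult.commute)
  ultimately have small: "exp (- 4 * s * real (card A)) \<le> \<bar>\<Prod>k\<in>A - B. 1 - l * \<eta> k\<bar>"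
    using l(3) by linarith
  have "3 ^ card B \<le> (\<Prod>k\<in>B. \<bar>1 - l * \<eta> k\<bar>)"
  proof -
    have "3 \<le> \<bar>1 - l * \<eta> k\<bar>" if "k \<in> B" for k
    proof -
      have "a * T \<le> l * \<eta> k" using that l a assms by (intro mult_mono) (auto simp: B_def)
      then show ?thesis using assms by (simp add: a_def)
    qed
    then have "(\<Prod>k\<in>B. 3) \<le> (\<Prod>k\<in>B. \<bar>1 - l * \<eta> k\<bar>)" by (intro prod_mono) auto
    then show ?thesis by simp
  qed
  then have big: "exp N \<le> \<bar>\<Prod>k\<in>B. 1 - l * \<eta> k\<bar>"
    using power_mono[OF exp_le, of "card B"]
    by (simp add: abs_prod N_def exp_of_nat_mult[symmetric])
  have "exp (ln a + 2 * (N - 4 * s * real (card A)))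
      = a * (exp N * exp (- 4 * s * real (card A)))\<^sup>2"
  proof -
    have "exp N * exp (- 4 * s * real (card A)) = exp (N - 4 * s * real (card A))"
      by (simp add: exp_add[symmetric])
    then show ?thesis using a by (simp only: exp_add exp_double) simp
  qed
  also have "\<dots> \<le> l * (\<bar>\<Prod>k\<in>B. 1 - l * \<eta> k\<bar> * \<bar>\<Prod>k\<in>A - B. 1 - l * \<eta> k\<bar>)\<^sup>2"
    using a l small big by (intro mult_mono power_mono) auto
  also have "\<bar>\<Prod>k\<in>B. 1 - l * \<eta> k\<bar> * \<bar>\<Prod>k\<in>A - B. 1 - l * \<eta> k\<bar> = \<bar>\<Prod>k\<in>A. 1 - l * \<eta> k\<bar>"
    using prod.subset_diff[of B A "\<lambda>k. 1 - l * \<eta> k"] assms(1)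
    by (simp add: B_def abs_mult mult.commute)
  also have "l * \<bar>\<Prod>k\<in>A. 1 - l * \<eta> k\<bar>\<^sup>2 \<le> exp 0"
    using bound[of l] l a by simp
  finally have "ln a + 2 * (N - 4 * s * real (card A)) \<le> 0" by (simp only: exp_le_cancel_iff)
  moreover have "ln a = ln 4 - ln T" using assms by (simp add: a_def ln_div)
  moreover have "0 \<le> ln (4::real)" by simp
  ultimately have "N \<le> 4 * s * real (card A) + ln T / 2" by argo
  then show ?thesis unfolding N_def B_def s(3) by simp
qed

lemma ex_power_bracket:
  assumes "1 \<le> (x::real)"
  obtains j :: nat where "4 ^ j \<le> x" "x < 4 ^ Suc j"
proof -
  have ex: "\<exists>m. x < 4 ^ m" by (rule real_arch_pow) simp
  define m where "m = (LEAST m. x < 4 ^ m)"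
  have m: "x < 4 ^ m" unfolding m_def using ex by (rule LeastI_ex)
  then obtain j where j: "m = Suc j" using assms by (cases m) auto
  then have "\<not> x < 4 ^ j" using not_less_Least[of j "\<lambda>m. x < 4 ^ m"] by (simp add: m_def)
  then show ?thesis using that[of j] m j by (simp add: not_less)
qed

text \<open>A dyadic layer decomposition with thresholds \<open>4 ^ i\<close>. By
  \<open>card_long_steps\<close>, layer \<open>i\<close> contributes at most
  \<open>8 * n * 2 ^ i + J * 4 ^ i\<close>; the sums are geometric and governed by the top layer,
  where \<open>2 ^ J \<le> sqrt H\<close> and \<open>4 ^ J \<le> H\<close>.\<close>

lemma sum_steps_bound:
  fixes \<eta> :: "'k \<Rightarrow> real"
  assumes A: "finite A" and H: "1 \<le> H" "\<And>k. k \<in> A \<Longrightarrow> \<eta> k \<le> H"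
    and bound: "\<And>l. 0 < l \<Longrightarrow> l \<le> 1 \<Longrightarrow> l * (\<Prod>k\<in>A. 1 - l * \<eta> k)\<^sup>2 \<le> 1"
  shows "sum \<eta> A \<le> 16 * real (card A) + 64 * real (card A) * sqrt H + 8 * H * ln H"
proof -
  define n where "n = real (card A)"
  obtain J :: nat where J: "4 ^ J \<le> H" "H < 4 ^ Suc J" using H(1) by (rule ex_power_bracket)
  \<comment> \<open>The layers start at \<open>i = 2\<close> because \<open>card_long_steps\<close>
    asks for a threshold of at least 16; shorter steps go into the constant. For a longer step, 4
    times the largest threshold below it is already enough.\<close>
  have layers: "\<eta> k \<le> 16 + 4 * (\<Sum>i=2..J. if 4 ^ i \<le> \<eta> k then 4 ^ i else 0)" if "k \<in> A" for k
  proof (cases "\<eta> k \<le> 16")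
    case True
    then show ?thesis by (smt (verit) sum_nonneg zero_le_power)
  next
    case False
    then obtain j :: nat where j: "4 ^ j \<le> \<eta> k" "\<eta> k < 4 ^ Suc j"
      using ex_power_bracket[of "\<eta> k"] by force
    have "(4::real) ^ 2 < 4 ^ Suc j" using j False by simp
    then have "2 \<le> j" by (subst (asm) power_strict_increasing_iff) auto
    moreover have "(4::real) ^ j < 4 ^ Suc J" using j J H(2)[OF that] by linarith
    then have "j \<le> J" by (subst (asm) power_strict_increasing_iff) auto
    ultimately have "(if 4 ^ j \<le> \<eta> k then 4 ^ j else 0)
        \<le> (\<Sum>i=2..J. if 4 ^ i \<le> \<eta> k then 4 ^ i else (0::real))"
      by (intro member_le_sum) auto
    then show ?thesis using j by simp
  qed
  have layer: "4 ^ i * real (card {k\<in>A. 4 ^ i \<le> \<eta> k}) \<le> 8 * n * 2 ^ i + real J * 4 ^ i"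
    if "i \<in> {2..J}" for i
  proof -
    have "(4::real) ^ 2 \<le> 4 ^ i" using that by (intro power_increasing) auto
    then have "real (card {k\<in>A. 4 ^ i \<le> \<eta> k}) \<le> 8 * n / sqrt (4 ^ i) + ln (4 ^ i) / 2"
      unfolding n_def by (intro card_long_steps[OF A _ bound]) auto
    also have "sqrt (4 ^ i) = 2 ^ i"
      by (simp add: real_sqrt_power)
    also have "ln ((4::real) ^ i) / 2 \<le> real J"
    proof -
      have "ln (4::real) = 2 * ln 2" using ln_realpow[of 2 2] by simp
      moreover have "ln (2::real) \<le> 1" using ln_le_minus_one[of "2::real"] by simp
      ultimately have "real i * ln 4 \<le> real J * 2" using that by (intro mult_mono) auto
      then show ?thesis by (simp add: ln_realpow)
    qed
    finally have "4 ^ i * real (card {k\<in>A. 4 ^ i \<le> \<eta> k}) \<le> 4 ^ i * (8 * n / 2 ^ i + real J)"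
      by (intro mult_left_mono) auto
    also have "\<dots> = 8 * n * 2 ^ i + real J * 4 ^ i"
    proof -
      have "(4::real) ^ i = 2 ^ i * 2 ^ i" by (simp add: power_mult_distrib[symmetric])
      then show ?thesis by (simp add: field_simps)
    qed
    finally show ?thesis .
  qed
  have geo2: "(\<Sum>i=2..J. 2 ^ i) \<le> 2 * (2::real) ^ J" by (induction J) auto
  have "3 * (\<Sum>i=2..J. 4 ^ i) \<le> 4 * (4::real) ^ J" by (induction J) auto
  then have geo4: "(\<Sum>i=2..J. 4 ^ i) \<le> 2 * H" using J(1) H(1) by linarith
  have J2: "2 ^ J \<le> sqrt H" using real_sqrt_le_mono[OF J(1)] by (simp add: real_sqrt_power)
  have "real J * 1 \<le> real J * ln 4"
    using ln_mono[of "exp 1" "4::real"] exp_le by (intro mult_left_mono) (auto intro: order_trans)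
  also have "\<dots> \<le> ln H" using ln_mono[OF J(1)] by (simp add: ln_realpow)
  finally have JH: "real J \<le> ln H" by simp
  have "sum \<eta> A \<le> (\<Sum>k\<in>A. 16 + 4 * (\<Sum>i=2..J. if 4 ^ i \<le> \<eta> k then 4 ^ i else 0))"
    by (intro sum_mono layers)
  also have "\<dots> = 16 * n + 4 * (\<Sum>i=2..J. \<Sum>k\<in>A. if 4 ^ i \<le> \<eta> k then 4 ^ i else 0)"
    by (subst sum.swap) (simp add: sum.distrib sum_distrib_left n_def)
  also have "(\<Sum>i=2..J. \<Sum>k\<in>A. if 4 ^ i \<le> \<eta> k then 4 ^ i else 0)
      = (\<Sum>i=2..J. 4 ^ i * real (card {k\<in>A. 4 ^ i \<le> \<eta> k}))"
    using A by (simp add: sum.If_cases Int_def mult.commute)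
  also have "\<dots> \<le> (\<Sum>i=2..J. 8 * n * 2 ^ i + real J * 4 ^ i)" by (intro sum_mono layer)
  also have "\<dots> = 8 * n * (\<Sum>i=2..J. 2 ^ i) + real J * (\<Sum>i=2..J. 4 ^ i)"
    by (simp add: sum.distrib sum_distrib_left)
  also have "\<dots> \<le> 8 * n * (2 * sqrt H) + ln H * (2 * H)"
    using geo2 geo4 J J2 JH H by (intro add_mono mult_mono) (auto simp: n_def sum_nonneg)
  finally show ?thesis by (simp add: n_def algebra_simps)
qed


section \<open>Growth of the step sums\<close>

text \<open>With the cube root as the basic quantity, the exponents 2/3 and 4/3 become the integer
  powers 2 and 4.\<close>

definition cbrt :: "nat \<Rightarrow> real"
  where "cbrt n = root 3 (real n)"

lemma cbrt_cube: "cbrt n ^ 3 = real n"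
  by (simp add: cbrt_def)

lemma cbrt_ge_1: "1 \<le> n \<Longrightarrow> 1 \<le> cbrt n"
  by (simp add: cbrt_def)

lemma cbrt_mono: "m \<le> n \<Longrightarrow> cbrt m \<le> cbrt n"
  by (simp add: cbrt_def)

lemma cbrt_Suc_le: "1 \<le> n \<Longrightarrow> cbrt (Suc n) \<le> 2 * cbrt n"
proof -
  assume "1 \<le> n"
  then have "cbrt (Suc n) \<le> root 3 (2 ^ 3 * real n)"
    unfolding cbrt_def by (intro real_root_le_mono) auto
  also have "\<dots> = 2 * cbrt n" unfolding cbrt_def by (subst real_root_mult) simp
  finally show ?thesis .
qed

text \<open>From \<open>1 = y ^ 3 - x ^ 3\<close>, factored. It bounds sums of n^(-2/3) by
  telescoping.\<close>

lemma inverse_cbrt_square_le: "1 / (cbrt (Suc n))\<^sup>2 \<le> 3 * (cbrt (Suc n) - cbrt n)"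
proof -
  define x y where "x = cbrt n" "y = cbrt (Suc n)"
  have xy: "0 \<le> x" "x \<le> y" "1 \<le> y"
    by (auto simp: x_y_def cbrt_mono cbrt_ge_1) (simp add: cbrt_def)
  have "1 = y ^ 3 - x ^ 3" by (simp add: x_y_def cbrt_cube)
  also have "\<dots> = (y - x) * (y * y + x * y + x * x)" by (simp add: power3_eq_cube algebra_simps)
  also have "\<dots> \<le> (y - x) * (y * y + y * y + y * y)"
    using xy by (intro mult_left_mono add_mono mult_mono) auto
  finally show ?thesis using xy unfolding x_y_def[symmetric]
    by (simp add: power2_eq_square field_simps)
qed

lemma filterlim_cbrt: "filterlim cbrt at_top sequentially"
  unfolding cbrt_def[abs_def] by real_asymp

text \<open>Choose \<open>p\<close> whose value exceeds all values up to \<open>m\<close>, and let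
  \<open>n\<close> be a maximiser of \<open>u\<close> on \<open>{..p}\<close>; it cannot lie before
  \<open>m\<close>.\<close>

lemma ex_record:
  fixes u :: "nat \<Rightarrow> real"
  assumes unbounded: "\<And>B. \<exists>n. B < u n"
  obtains n where "m \<le> n" "\<And>k. k \<le> n \<Longrightarrow> u k \<le> u n"
proof -
  obtain p where p: "Max (u ` {..m}) < u p" using unbounded by blast
  obtain n where n: "n \<le> p" "\<And>k. k \<le> p \<Longrightarrow> u k \<le> u n"
    using Max_in[of "u ` {..p}"] Max_ge[of "u ` {..p}"] by fastforce
  have "m \<le> n"
  proof (rule ccontr)
    assume "\<not> m \<le> n"
    then have "u n \<le> Max (u ` {..m})" by (intro Max_ge) auto
    then show False using p n(2)[of p] by linarith
  qed
  then show ?thesis using that n by auto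
qed

text \<open>The hypotheses are the three constraints with \<epsilon> = 1/10000, freed of the rate.
  At a record, the three terms of \<open>sum_steps_bound\<close> are at most 1/100, 3/10 and 8/25 of
  \<open>S n\<close>, which add up to less than \<open>S n\<close>.\<close>

lemma no_fast_schedule:
  assumes pos: "\<forall>k\<ge>1. 0 < \<eta> k"
    and sum_large: "\<And>n. N \<le> n \<Longrightarrow> 10000 * cbrt n ^ 4 \<le> 2 * step_sum \<eta> n + 1"
    and step_small: "\<And>n. N \<le> n \<Longrightarrow> 100 * \<bar>\<eta> (Suc n) - 1\<bar> * (cbrt (Suc n))\<^sup>2 \<le> 1 + step_sum \<eta> n"
    and poly_small: "\<And>n l. N \<le> n \<Longrightarrow> 0 < l \<Longrightarrow> l \<le> 1 \<Longrightarrow> l * (\<Prod>k=1..n. 1 - l * \<eta> k)\<^sup>2 \<le> 1"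
    and "1 \<le> N"
  shows False
proof -
  define S where "S = step_sum \<eta>"
  define u where "u n = S n / (cbrt n)\<^sup>2" for n
  have S_nonneg: "0 \<le> S n" for n unfolding S_def by (rule step_sum_nonneg[OF pos])
  have S_large: "2500 * cbrt n ^ 4 \<le> S n" "1 \<le> cbrt n" "1 \<le> S n" if "N \<le> n" for n
  proof -
    show q: "1 \<le> cbrt n" using that \<open>1 \<le> N\<close> by (intro cbrt_ge_1) simp
    then have "1 \<le> cbrt n ^ 4" by (rule one_le_power)
    then show "2500 * cbrt n ^ 4 \<le> S n" "1 \<le> S n" using sum_large[OF that] by (auto simp: S_def)
  qed
  \<comment> \<open>The 1 in \<open>\<eta> (Suc n) - 1\<close> is absorbed by
    \<open>100 * q\<^sup>2 \<le> 1 + S n\<close>, at the cost of replacing 100 by 50.\<close>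
  have step_le: "\<eta> (Suc n) \<le> (1 + S n) / 50 / (cbrt (Suc n))\<^sup>2" if n: "N \<le> n" for n
  proof -
    define q where "q = cbrt (Suc n)"
    have q: "1 \<le> q" "q \<le> 2 * cbrt n"
      using n \<open>1 \<le> N\<close> by (auto simp: q_def intro!: cbrt_ge_1 cbrt_Suc_le)
    then have "q\<^sup>2 \<le> (2 * cbrt n)\<^sup>2" by (intro power_mono) auto
    also have "\<dots> \<le> 4 * cbrt n ^ 4"
      using power_increasing[of 2 4 "cbrt n"] S_large(2)[OF n] by (simp add: power_mult_distrib)
    finally have "100 * q\<^sup>2 \<le> 1 + S n" using S_large(1,3)[OF n] by simp
    moreover have "100 * (\<eta> (Suc n) - 1) * q\<^sup>2 \<le> 100 * \<bar>\<eta> (Suc n) - 1\<bar> * q\<^sup>2"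
      by (intro mult_right_mono mult_left_mono abs_ge_self) auto
    ultimately have "50 * \<eta> (Suc n) * q\<^sup>2 \<le> 1 + S n"
      using step_small[OF n] by (simp add: S_def q_def algebra_simps)
    then show ?thesis using q unfolding q_def[symmetric] by (simp add: field_simps)
  qed
  define K where "K = ln (1 + S N)"
  \<comment> \<open>By \<open>step_le\<close>, each step multiplies \<open>1 + S n\<close> by at
    most \<open>1 + 1 / (50 * q\<^sup>2)\<close>; the logarithms telescope by
    \<open>inverse_cbrt_square_le\<close>.\<close>
  have growth: "ln (1 + S n) \<le> K + cbrt n" if "N \<le> n" for n
    using that
  proof (induction n rule: dec_induct)
    case base
    show ?case using S_large(2)[of N] by (simp add: K_def)
  next
    case (step n)
    define q where "q = cbrt (Suc n)"
    have q: "1 \<le> q" by (auto simp: q_def intro!: cbrt_ge_1)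
    have "1 + S (Suc n) \<le> (1 + S n) * (1 + 1 / (50 * q\<^sup>2))"
      using step_le[OF step.hyps(1)]
      by (simp add: S_def q_def algebra_simps)
    also have "\<dots> \<le> (1 + S n) * exp (1 / (50 * q\<^sup>2))"
      using S_nonneg[of n] by (intro mult_left_mono exp_ge_add_one_self) auto
    finally have "ln (1 + S (Suc n)) \<le> ln ((1 + S n) * exp (1 / (50 * q\<^sup>2)))"
      using S_nonneg[of "Suc n"] by (intro ln_mono) auto
    also have "\<dots> = ln (1 + S n) + 1 / (50 * q\<^sup>2)"
      using S_nonneg[of n] by (simp add: ln_mult)
    also have "1 / (50 * q\<^sup>2) \<le> cbrt (Suc n) - cbrt n"
      using inverse_cbrt_square_le[of n] cbrt_mono[of n "Suc n"] unfolding q_def[symmetric] by simp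
    finally show ?case using step.IH by simp
  qed
  have unbounded: "\<exists>n. B < u n" for B
  proof -
    have "eventually (\<lambda>n. max 1 \<bar>B\<bar> < cbrt n \<and> N \<le> n) sequentially"
      using filterlim_cbrt eventually_ge_at_top[of N] unfolding filterlim_at_top_dense
      by (intro eventually_conj) blast+
    then obtain n where n: "1 < cbrt n" "\<bar>B\<bar> < cbrt n" "N \<le> n"
      by (auto dest!: eventually_happens)
    have "B * (cbrt n)\<^sup>2 \<le> cbrt n * (cbrt n)\<^sup>2" using n by (intro mult_right_mono) auto
    also have "\<dots> = cbrt n ^ 3" by (simp add: power2_eq_square power3_eq_cube)
    also have "\<dots> < cbrt n ^ 4" using n by (intro power_strict_increasing) auto
    also have "\<dots> \<le> S n" using S_large[OF n(3)] by simp
    finally show ?thesis using n by (auto simp: u_def field_simps intro!: exI[of _ n])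
  qed
  \<comment> \<open>The first \<open>N\<close> steps are not covered by \<open>step_le\<close>.
    Beyond \<open>m\<close>, the cube root of the index dominates both their maximum and the
    constant \<open>K\<close>.\<close>
  define M where "M = Max (\<eta> ` {..N})"
  have "eventually (\<lambda>n. max (max 2 \<bar>M\<bar>) \<bar>K\<bar> < cbrt n) sequentially"
    using filterlim_cbrt unfolding filterlim_at_top_dense by blast
  then obtain m where m: "\<And>n. m \<le> n \<Longrightarrow> max (max 2 \<bar>M\<bar>) \<bar>K\<bar> < cbrt n"
    by (auto simp: eventually_sequentially)
  obtain n where n: "max N m \<le> n" and maximal: "\<And>k. k \<le> n \<Longrightarrow> u k \<le> u n"
    using ex_record[of u "max N m"] unbounded by blast
  define q where "q = cbrt n"
  have q: "2 < q" "\<bar>M\<bar> < q" "\<bar>K\<bar> < q" using m[of n] n by (auto simp: q_def)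
  have Sn: "2500 * q ^ 4 \<le> S n" "1 \<le> S n" using S_large[of n] n by (auto simp: q_def)
  \<comment> \<open>For \<open>k\<close> beyond \<open>N\<close>, \<open>step_le\<close> and
    \<open>1 + S (k - 1) \<le> 2 * S k\<close> give \<open>\<eta> k \<le> u k / 25\<close>, and the
    record property bounds this by \<open>H\<close>.\<close>
  define H where "H = u n / 25"
  have H: "H = S n / (25 * q\<^sup>2)" by (simp add: H_def u_def q_def)
  have "q * q\<^sup>2 \<le> q\<^sup>2 * q\<^sup>2"
    using q by (intro mult_right_mono) (auto simp: power2_eq_square)
  also have "\<dots> = q ^ 4" by (simp add: power_add[symmetric])
  finally have "25 * (q * q\<^sup>2) \<le> S n" using Sn by linarith
  then have "q \<le> H" using q by (simp add: H field_simps)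
  have steps_le_H: "\<eta> k \<le> H" if "k \<in> {1..n}" for k
  proof (cases "k \<le> N")
    case True
    then have "\<eta> k \<le> M" unfolding M_def by (intro Max_ge) auto
    then show ?thesis using q \<open>q \<le> H\<close> by simp
  next
    case False
    then obtain j where j: "k = Suc j" "N \<le> j" by (cases k) auto
    have "0 < \<eta> (Suc j)" using pos by simp
    then have "1 + S j \<le> 2 * S k" using S_large(3)[OF j(2)] by (simp add: S_def j)
    then have "(1 + S j) / 50 / (cbrt k)\<^sup>2 \<le> 2 * S k / 50 / (cbrt k)\<^sup>2"
      by (intro divide_right_mono) auto
    also have "\<dots> = u k / 25" by (simp add: u_def)
    also have "\<dots> \<le> H" unfolding H_def using maximal[of k] that by simp
    finally show ?thesis using step_le[OF j(2)] j(1) by simp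
  qed
  have "S n \<le> 16 * real n + 64 * real n * sqrt H + 8 * H * ln H"
    using sum_steps_bound[of "{1..n}" H \<eta>] steps_le_H q \<open>q \<le> H\<close> poly_small[of n] n
    by (simp add: S_def step_sum_def)
  moreover have "16 * real n \<le> S n / 100"
  proof -
    have "real n = q ^ 3" by (simp add: q_def cbrt_cube)
    also have "\<dots> \<le> q ^ 4" using q by (intro power_increasing) auto
    finally show ?thesis using Sn(1) by simp
  qed
  \<comment> \<open>The decisive term: it equals \<open>64 / 5 * q\<^sup>2 * sqrt (S n)\<close>, and
    the lower bound on the step sums gives \<open>q\<^sup>2 \<le> sqrt (S n) / 50\<close>. The small
    \<epsilon> makes the resulting fraction of \<open>S n\<close> small.\<close>
  moreover have "64 * real n * sqrt H \<le> S n * 3 / 10"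
  proof -
    have "q\<^sup>2 * 50 = sqrt (2500 * q ^ 4)"
      by (rule real_sqrt_unique[symmetric]) (auto simp: power_mult_distrib)
    also have "\<dots> \<le> sqrt (S n)" using Sn(1) by simp
    finally have q2: "q\<^sup>2 * 50 \<le> sqrt (S n)" .
    have "64 * real n * sqrt H = 64 * q ^ 3 * (sqrt (S n) / (5 * q))"
      using q unfolding H by (simp add: real_sqrt_divide real_sqrt_mult q_def cbrt_cube)
    also have "\<dots> = 64 / 5 * q\<^sup>2 * sqrt (S n)"
      using q by (simp add: power2_eq_square power3_eq_cube)
    also have "\<dots> \<le> 64 / 5 * (sqrt (S n) / 50) * sqrt (S n)"
      using q2 Sn by (intro mult_right_mono mult_left_mono) auto
    also have "\<dots> = 64 / 250 * S n" using Sn by simp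
    also have "\<dots> \<le> S n * 3 / 10" using Sn by simp
    finally show ?thesis .
  qed
  \<comment> \<open>Here \<open>growth\<close> enters: \<open>ln H\<close> is at most
    \<open>K + q\<close>, hence at most \<open>q\<^sup>2\<close>, while \<open>H * q\<^sup>2\<close>
    is \<open>S n / 25\<close>.\<close>
  moreover have "8 * H * ln H \<le> S n * 8 / 25"
  proof -
    have "1 \<le> q\<^sup>2" using q by (intro one_le_power) simp
    then have "S n * 1 \<le> S n * (25 * q\<^sup>2)" using Sn by (intro mult_left_mono) auto
    then have "H \<le> S n" using q unfolding H by (simp add: field_simps)
    then have "ln H \<le> ln (1 + S n)" using \<open>q \<le> H\<close> q by (intro ln_mono) auto
    also have "\<dots> \<le> K + q" unfolding q_def using growth[of n] n by simp
    also have "\<dots> \<le> q\<^sup>2" using q mult_right_mono[of 2 q q] unfolding power2_eq_square by linarith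
    finally have "8 * H * ln H \<le> 8 * H * q\<^sup>2" using \<open>q \<le> H\<close> q by (intro mult_left_mono) auto
    also have "\<dots> = S n * 8 / 25" using q by (simp add: H)
    finally show ?thesis .
  qed
  ultimately show False using Sn(2) by linarith
qed

theorem theorem1p1:
  shows "\<not> (\<exists>\<eta> :: nat \<Rightarrow> real. (\<forall>k\<ge>1. 0 < \<eta> k) \<and>
    ((\<lambda>n. ereal (real n powr (4/3)) * worst_case_rate \<eta> n) \<longlonglongrightarrow> 0))"
proof
  assume "\<exists>\<eta> :: nat \<Rightarrow> real. (\<forall>k\<ge>1. 0 < \<eta> k) \<and>
    ((\<lambda>n. ereal (real n powr (4/3)) * worst_case_rate \<eta> n) \<longlonglongrightarrow> 0)"
  then obtain \<eta> :: "nat \<Rightarrow> real" where pos: "\<forall>k\<ge>1. 0 < \<eta> k"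
    and lim: "(\<lambda>n. ereal (real n powr (4/3)) * worst_case_rate \<eta> n) \<longlonglongrightarrow> 0" by blast
  have "\<forall>\<^sub>F n in sequentially. ereal (real n powr (4/3)) * worst_case_rate \<eta> n < ereal (1 / 10000)"
    using lim by (rule order_tendstoD) simp
  then obtain N where N: "\<And>n. N \<le> n \<Longrightarrow>
      ereal (real n powr (4/3)) * worst_case_rate \<eta> n < ereal (1 / 10000)"
    by (auto simp: eventually_sequentially)
  have small: "10000 * cbrt n ^ 4 * v \<le> 1"
    if "N \<le> n" "1 \<le> n" "ereal v \<le> worst_case_rate \<eta> n" for n v
  proof -
    have "real n powr (4/3) = (real n powr (1/3)) ^ 4"
      using that by (simp add: powr_power)
    then have powr: "real n powr (4/3) = cbrt n ^ 4"
      using that by (simp add: cbrt_def root_powr_inverse)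
    have "ereal (cbrt n ^ 4 * v) = ereal (cbrt n ^ 4) * ereal v" by simp
    also have "\<dots> \<le> ereal (cbrt n ^ 4) * worst_case_rate \<eta> n"
      using that(3) by (intro ereal_mult_left_mono) auto
    also have "\<dots> < ereal (1 / 10000)" using N[OF that(1)] powr by simp
    finally show ?thesis by simp
  qed
  show False
  proof (rule no_fast_schedule[OF pos, of "max N 1"])
    fix n assume n: "max N 1 \<le> n"
    show "10000 * cbrt n ^ 4 \<le> 2 * step_sum \<eta> n + 1"
      using small[OF _ _ rate_ge_step_sum[OF pos, of n]] n step_sum_nonneg[OF pos, of n]
      by (simp add: field_simps)
    \<comment> \<open>The bound from \<open>rate_ge_step\<close> is a square, so 10000 times the
      fourth power of the cube root turns into 100 times its square after taking roots.\<close>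
    define x where "x = \<bar>\<eta> (Suc n) - 1\<bar> / (1 + step_sum \<eta> n)"
    have "ereal (x\<^sup>2) \<le> worst_case_rate \<eta> (Suc n)"
      using rate_ge_step[OF pos, of n] by (simp add: x_def power_divide)
    then have "(100 * (cbrt (Suc n))\<^sup>2 * x)\<^sup>2 \<le> 1\<^sup>2"
      using small[of "Suc n" "x\<^sup>2"] n by (simp add: power_mult_distrib)
    then have "100 * (cbrt (Suc n))\<^sup>2 * x \<le> 1" by (rule power2_le_imp_le) simp
    then show "100 * \<bar>\<eta> (Suc n) - 1\<bar> * (cbrt (Suc n))\<^sup>2 \<le> 1 + step_sum \<eta> n"
      using step_sum_nonneg[OF pos, of n] by (simp add: x_def field_simps)
    fix l :: real assume l: "0 < l" "l \<le> 1"
    define v where "v = l * (\<Prod>k=1..n. 1 - l * \<eta> k)\<^sup>2"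
    have "10000 * cbrt n ^ 4 * v \<le> 1"
      unfolding v_def using n by (intro small rate_ge_quadratic l) auto
    moreover have "1 * v \<le> 10000 * cbrt n ^ 4 * v"
      using one_le_power[OF cbrt_ge_1, of n 4] n l by (intro mult_right_mono) (auto simp: v_def)
    ultimately show "l * (\<Prod>k=1..n. 1 - l * \<eta> k)\<^sup>2 \<le> 1" by (simp add: v_def)
  qed simp
qed

end
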